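(* Every trace-free real quadratic form in three variables allows a normal form of the type $A(x^2-y^2)+Bxz$ with $A,B\in\mathbb{R}$. That is, for every trace-free quadratic form $q$ on Euclidean space $\mathbb{R}^3$ there exist an orthonormal basis $(e_1,e_2,e_3)$ of $\mathbb{R}^3$ and $A,B\in\mathbb{R}$ such that $q(xe_1+ye_2+ze_3)=A(x^2-y^2)+Bxz$ for all $x,y,z\in\mathbb{R}$.
   Context: A real quadratic form $q$ on $\mathbb{R}^3$ is called trace-free if the real symmetric $3\times3$-matrix $S$ with $q(v)=v^{T}Sv$ has trace zero. An expression in terms of fixed quadratic forms with real coefficients is a normal form of $q$ if $q$ takes that form, for some set of coefficients, in some orthonormal basis. *)

theory Defs
  imports "HOL-Analysis.Analysis"
begin

definition represents_form :: "real ^ 'n ^ 'n \<Rightarrow> (real ^ 'n \<Rightarrow> real) \<Rightarrow> bool" where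
  "represents_form S q \<longleftrightarrow> transpose S = S \<and> (\<forall>v. q v = v \<bullet> (S *v v))"

definition quadratic_form :: "(real ^ 'n \<Rightarrow> real) \<Rightarrow> bool" where
  "quadratic_form q \<longleftrightarrow> (\<exists>S. represents_form S q)"

lemma represents_form_unique:
  fixes S T :: "real ^ 'n ^ 'n"
  assumes "represents_form S q" "represents_form T q"
  shows "S = T"
proof -
  have polar: "q (u + v) - q u - q v = 2 * (u \<bullet> (R *v v))"
    if R: "represents_form R q" for R :: "real ^ 'n ^ 'n" and u v
  proof -
    have "v \<bullet> (R *v u) = u \<bullet> (R *v v)"
      using R by (metis represents_form_def dot_lmul_matrix inner_commute transpose_matrix_vector)
    then show ?thesis
      using R by (simp add: represents_form_def matrix_vector_right_distrib inner_add_left inner_add_right)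
  qed
  have "u \<bullet> (S *v v) = u \<bullet> (T *v v)" for u v
    using polar[OF assms(1), of u v] polar[OF assms(2), of u v] by simp
  then have "S *v v = T *v v" for v
    by (metis vector_eq_rdot inner_commute)
  then show ?thesis
    by (simp add: matrix_eq)
qed

text \<open>
  By \<open>represents_form_unique\<close>, a quadratic form has exactly one symmetric matrix.
\<close>

definition form_matrix :: "(real ^ 'n \<Rightarrow> real) \<Rightarrow> real ^ 'n ^ 'n" where
  "form_matrix q = (THE S. represents_form S q)"

lemma form_matrix_eq: "represents_form S q \<Longrightarrow> form_matrix q = S"
  unfolding form_matrix_def using represents_form_unique by blast

text \<open>Only meaningful for quadratic forms \<open>q\<close>, since otherwise \<open>form_matrix q\<close> is unspecified.\<close>

definition trace_free :: "(real ^ 'n \<Rightarrow> real) \<Rightarrow> bool" where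
  "trace_free q \<longleftrightarrow> trace (form_matrix q) = 0"

definition orthonormal_basis3 :: "real ^ 3 \<Rightarrow> real ^ 3 \<Rightarrow> real ^ 3 \<Rightarrow> bool" where
  "orthonormal_basis3 e1 e2 e3 \<longleftrightarrow>
     norm e1 = 1 \<and> norm e2 = 1 \<and> norm e3 = 1 \<and>
     orthogonal e1 e2 \<and> orthogonal e1 e3 \<and> orthogonal e2 e3 \<and>
     independent {e1, e2, e3} \<and> span {e1, e2, e3} = UNIV"

end

theory Submission
  imports Defs
begin

text \<open>
  In an orthonormal basis \<open>e1, e2, e3\<close> the form \<open>A * (x\<^sup>2 - y\<^sup>2) + B * x * z\<close> has a matrix in which \<open>e2\<close>
  is an eigenvector and \<open>e3\<close> is isotropic, and conversely: if \<open>e2\<close> is an eigenvector and \<open>q e3 = 0\<close>,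
  then the mixed terms with \<open>y\<close> and the \<open>z\<^sup>2\<close> term vanish, and trace zero forces
  \<open>q e1 = - q e2\<close>. So what is needed is a unit eigenvector whose orthogonal plane contains an
  isotropic unit vector. An eigenvector for the middle eigenvalue has this property, because its
  orthogonal plane is spanned by eigenvectors for the largest eigenvalue \<open>l\<close> and the smallest
  eigenvalue \<open>m\<close>, and \<open>m \<le> 0 \<le> l\<close> when the trace vanishes.

  The extremal eigenvectors \<open>u\<close> and \<open>w\<close> are a maximum and a minimum point of \<open>q\<close> on the unit
  sphere (\<open>extremal_eigenvectors\<close>). They are orthogonal unless \<open>l = m\<close>, in which case \<open>q = 0\<close>. Their
  cross product serves as \<open>e2\<close>, and a rotation in the plane of \<open>u\<close> and \<open>w\<close> yields the isotropic
  \<open>e3\<close>. The value \<open>q e2\<close> follows from the trace, which is the sum of the values of \<open>q\<close> on any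
  orthonormal basis (\<open>trace_eq_sum_orthonormal3\<close>).
\<close>

lemma orthonormal_basis3I:
  assumes "norm e1 = 1" "norm e2 = 1" "norm e3 = 1"
    and "orthogonal e1 e2" "orthogonal e1 e3" "orthogonal e2 e3"
  shows "orthonormal_basis3 e1 e2 e3"
proof -
  have nz: "e1 \<noteq> 0" "e2 \<noteq> 0" "e3 \<noteq> 0"
    using assms(1-3) by auto
  have ne: "e1 \<noteq> e2" "e1 \<noteq> e3" "e2 \<noteq> e3"
    using assms(4-6) nz by (auto simp: orthogonal_self)
  have "pairwise orthogonal {e1, e2, e3}"
    using assms(4-6) by (auto simp: pairwise_insert orthogonal_commute)
  then have ind: "independent {e1, e2, e3}"
    using nz by (intro pairwise_orthogonal_independent) auto
  moreover have "card {e1, e2, e3} = 3"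
    using ne by simp
  ultimately have "span {e1, e2, e3} = UNIV"
    using card_ge_dim_independent[of "{e1, e2, e3}" "UNIV :: (real^3) set"] by auto
  with ind assms show ?thesis
    by (simp add: orthonormal_basis3_def)
qed

text \<open>
  With the basis vectors as the rows of an orthogonal matrix \<open>P\<close>, the right-hand side is the trace
  of \<open>P ** S ** transpose P\<close>, and the trace is invariant under cyclic permutation of factors.
\<close>

lemma trace_eq_sum_orthonormal3:
  fixes S :: "real ^ 3 ^ 3"
  assumes "norm e1 = 1" "norm e2 = 1" "norm e3 = 1"
    and "orthogonal e1 e2" "orthogonal e1 e3" "orthogonal e2 e3"
  shows "trace S = e1 \<bullet> (S *v e1) + e2 \<bullet> (S *v e2) + e3 \<bullet> (S *v e3)"
proof -
  define P :: "real ^ 3 ^ 3" where "P = vector [e1, e2, e3]"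
  have rows: "P $ 1 = e1" "P $ 2 = e2" "P $ 3 = e3"
    by (simp_all add: P_def)
  have "(P ** transpose P) $ i $ j = P $ i \<bullet> P $ j" for i j
    by (simp add: matrix_matrix_mult_def transpose_def inner_vec_def)
  then have "P ** transpose P = mat 1"
    using assms
    by (simp add: vec_eq_iff mat_def forall_3 rows orthogonal_def norm_eq_1
        inner_commute[of e2 e1] inner_commute[of e3 e1] inner_commute[of e3 e2])
  then have "transpose P ** P = mat 1"
    using matrix_left_right_inverse by blast
  then have "trace S = trace (S ** (transpose P ** P))"
    by simp
  also have "\<dots> = trace (P ** (S ** transpose P))"
    by (metis matrix_mul_assoc trace_mul_sym)
  also have "\<dots> = e1 \<bullet> (S *v e1) + e2 \<bullet> (S *v e2) + e3 \<bullet> (S *v e3)"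
    by (simp add: trace_def sum_3 matrix_matrix_mult_def matrix_vector_mult_def
        inner_vec_def transpose_def rows)
  finally show ?thesis .
qed

lemma symmetric_matrix_inner_commute:
  fixes S :: "real ^ 'n ^ 'n"
  assumes "transpose S = S"
  shows "v \<bullet> (S *v w) = w \<bullet> (S *v v)"
  using assms by (metis dot_lmul_matrix inner_commute transpose_matrix_vector)

text \<open>
  At a maximum point \<open>u\<close> with value \<open>l\<close> the form \<open>l * (v \<bullet> v) - v \<bullet> (S *v v)\<close> is positive
  semidefinite and vanishes at \<open>u\<close>. A null vector of a positive semidefinite form lies in the
  kernel of its matrix, which here says \<open>S *v u = l *\<^sub>R u\<close>. This is the variational route to the first
  eigenvector in the spectral theorem.
\<close>

lemma maximum_on_sphere_is_eigenvector:
  fixes S :: "real ^ 'n ^ 'n"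
  assumes sym: "transpose S = S"
  obtains u l where "norm u = 1" "S *v u = l *\<^sub>R u" "\<And>v. v \<bullet> (S *v v) \<le> l * (v \<bullet> v)"
proof -
  have "continuous_on (sphere 0 1) (\<lambda>v. v \<bullet> (S *v v))"
    by (intro continuous_intros matrix_vector_mult_linear_continuous_on)
  moreover have "sphere (0 :: real ^ 'n) 1 \<noteq> {}"
    by simp
  ultimately obtain u where u: "norm u = 1"
    and max: "\<And>v. norm v = 1 \<Longrightarrow> v \<bullet> (S *v v) \<le> u \<bullet> (S *v u)"
    using continuous_attains_sup[of "sphere (0 :: real ^ 'n) 1"] by fastforce
  define l where "l = u \<bullet> (S *v u)"
  have bound: "v \<bullet> (S *v v) \<le> l * (v \<bullet> v)" for v
  proof (cases "v = 0")
    case False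
    define w where "w = v /\<^sub>R norm v"
    have v: "v = norm v *\<^sub>R w" and w: "norm w = 1"
      using False by (simp_all add: w_def)
    have "v \<bullet> (S *v v) = (norm v)\<^sup>2 * (w \<bullet> (S *v w))"
      by (subst (1 2) v) (simp add: scaleR_matrix_vector_assoc [symmetric]
          matrix_vector_mult_scaleR power2_eq_square)
    also have "\<dots> \<le> (norm v)\<^sup>2 * l"
      using max[OF w] by (simp add: l_def mult_left_mono)
    finally show ?thesis
      by (simp add: power2_norm_eq_inner mult.commute)
  qed simp
  have "S *v u = l *\<^sub>R u"
  proof -
    (* The vector w is half the gradient of the semidefinite form at u. Along the line
       u + t w the form is a quadratic polynomial in t without constant term. Being nonnegative
       near t = 0, it has no linear term, so w = 0. *)
    define w where "w = l *\<^sub>R u - S *v u"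
    define d where "d = l * (w \<bullet> w) - w \<bullet> (S *v w)"
    have quad: "0 \<le> 2 * t * (w \<bullet> w) + t\<^sup>2 * d" for t
    proof -
      have "0 \<le> l * ((u + t *\<^sub>R w) \<bullet> (u + t *\<^sub>R w)) - (u + t *\<^sub>R w) \<bullet> (S *v (u + t *\<^sub>R w))"
        using bound[of "u + t *\<^sub>R w"] by simp
      also have "\<dots> = l * (u \<bullet> u) - u \<bullet> (S *v u) + 2 * t * (w \<bullet> (l *\<^sub>R u - S *v u)) + t\<^sup>2 * d"
        by (simp add: d_def matrix_vector_right_distrib matrix_vector_mult_scaleR
            symmetric_matrix_inner_commute[OF sym, of u w] inner_commute[of u w] inner_simps
            power2_eq_square algebra_simps)
      also have "\<dots> = 2 * t * (w \<bullet> w) + t\<^sup>2 * d"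
        using u by (simp add: l_def w_def norm_eq_1)
      finally show ?thesis .
    qed
    have "0 \<le> d"
      using bound[of w] by (simp add: d_def)
    (* The argument - r is a step against the gradient; the summand 1 keeps the denominator
       positive when d = 0, and with this step length the decrease of the linear term
       outweighs the quadratic term. *)
    define r where "r = (w \<bullet> w) / (d + 1)"
    have r: "w \<bullet> w = r * (d + 1)"
      using \<open>0 \<le> d\<close> by (simp add: r_def)
    have "0 \<le> - (r\<^sup>2 * (d + 2))"
      using quad[of "- r"] by (simp add: r power2_eq_square algebra_simps)
    with \<open>0 \<le> d\<close> have "r = 0"
      by (simp add: mult_le_0_iff)
    then have "w \<bullet> w = 0"
      using r by simp
    then show ?thesis
      by (simp add: w_def)
  qed
  with u bound show ?thesis
    using that by blast
qed

lemma extremal_eigenvectors: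
  fixes S :: "real ^ 'n ^ 'n"
  assumes sym: "transpose S = S"
  obtains u l w m where "norm u = 1" "S *v u = l *\<^sub>R u" "norm w = 1" "S *v w = m *\<^sub>R w"
    "\<And>v. m * (v \<bullet> v) \<le> v \<bullet> (S *v v)" "\<And>v. v \<bullet> (S *v v) \<le> l * (v \<bullet> v)"
proof -
  obtain u l where u: "norm u = 1" "S *v u = l *\<^sub>R u" "\<And>v. v \<bullet> (S *v v) \<le> l * (v \<bullet> v)"
    using maximum_on_sphere_is_eigenvector[OF sym] by blast
  have neg: "(- S) *v v = - (S *v v)" for v
    by (simp add: vec_eq_iff matrix_vector_mult_def sum_negf)
  have "transpose (- S) = - S"
    using sym by (simp add: vec_eq_iff transpose_def)
  then obtain w m where w: "norm w = 1" "(- S) *v w = m *\<^sub>R w"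
      "\<And>v. v \<bullet> ((- S) *v v) \<le> m * (v \<bullet> v)"
    using maximum_on_sphere_is_eigenvector by blast
  have "- m * (v \<bullet> v) \<le> v \<bullet> (S *v v)" for v
    using w(3)[of v] by (simp add: neg)
  moreover have "S *v w = (- m) *\<^sub>R w"
    using w(2) by (simp add: neg) (metis minus_equation_iff)
  ultimately show ?thesis
    using that u w(1) by blast
qed

text \<open>
  The diagonal entries of \<open>S\<close> are values of the form at unit vectors, so they lie between \<open>m\<close>
  and \<open>l\<close>, and so does their average, which is zero.
\<close>

lemma trace_free_extremal_signs:
  fixes S :: "real ^ 'n ^ 'n"
  assumes "trace S = 0"
    and "\<And>v. m * (v \<bullet> v) \<le> v \<bullet> (S *v v)" "\<And>v. v \<bullet> (S *v v) \<le> l * (v \<bullet> v)"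
  shows "m \<le> 0" "0 \<le> l"
proof -
  have ax: "axis i 1 \<bullet> (S *v axis i 1) = S $ i $ i" for i
    by (simp add: inner_axis' matrix_vector_mul_component inner_axis)
  have "m \<le> S $ i $ i" "S $ i $ i \<le> l" for i
    using assms(2,3)[of "axis i 1"] by (simp_all add: ax inner_axis_axis)
  then have "(\<Sum>i\<in>(UNIV :: 'n set). m) \<le> trace S" "trace S \<le> (\<Sum>i\<in>(UNIV :: 'n set). l)"
    unfolding trace_def by (blast intro: sum_mono)+
  then show "m \<le> 0" "0 \<le> l"
    using assms(1) by (simp_all add: mult_le_0_iff zero_le_mult_iff)
qed

theorem corollary1p2:
  fixes q :: "real ^ 3 \<Rightarrow> real"
  assumes "quadratic_form q" and "trace_free q"
  shows "\<exists>e1 e2 e3. orthonormal_basis3 e1 e2 e3 \<and>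
    (\<exists>A B :: real. \<forall>x y z :: real.
       q (x *\<^sub>R e1 + y *\<^sub>R e2 + z *\<^sub>R e3) = A * (x\<^sup>2 - y\<^sup>2) + B * x * z)"
proof -
  obtain S where S: "represents_form S q"
    using assms(1) by (auto simp: quadratic_form_def)
  then have sym: "transpose S = S" and q: "\<And>v. q v = v \<bullet> (S *v v)"
    by (auto simp: represents_form_def)
  have tr: "trace S = 0"
    using assms(2) form_matrix_eq[OF S] by (simp add: trace_free_def)
  obtain u l w m where u: "norm u = 1" "S *v u = l *\<^sub>R u" and w: "norm w = 1" "S *v w = m *\<^sub>R w"
    and bounds: "\<And>v. m * (v \<bullet> v) \<le> v \<bullet> (S *v v)" "\<And>v. v \<bullet> (S *v v) \<le> l * (v \<bullet> v)"
    using extremal_eigenvectors[OF sym] by blast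
  have signs: "m \<le> 0" "0 \<le> l"
    using trace_free_extremal_signs[OF tr bounds] by auto
  show ?thesis
  proof (cases "l = m")
    case True
    with signs have "l = 0" "m = 0"
      by linarith+
    then have "q v = 0" for v
      using bounds[of v] by (simp add: q)
    moreover have "orthonormal_basis3 (axis 1 1) (axis 2 1) (axis 3 1)"
      by (intro orthonormal_basis3I) (auto simp: orthogonal_def inner_axis_axis)
    ultimately show ?thesis
      by (intro exI[of _ "axis 1 1"] exI[of _ "axis 2 1"] exI[of _ "axis 3 1"]
          conjI exI[of _ 0]) simp_all
  next
    case False
    then have gap: "0 < l - m"
      using signs by linarith
    have "l * (w \<bullet> u) = m * (w \<bullet> u)"
      using symmetric_matrix_inner_commute[OF sym, of w u] u(2) w(2) by (simp add: inner_commute)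
    then have uw: "u \<bullet> w = 0"
      using False by (simp add: inner_commute)
    (* q (c u + s w) = l c^2 + m s^2 for a unit vector in the plane of u and w; these values of
       c and s are the nonnegative solution of l c^2 + m s^2 = 0 and c^2 + s^2 = 1. *)
    define c s where "c = sqrt (- m / (l - m))" and "s = sqrt (l / (l - m))"
    have c2: "c\<^sup>2 = - m / (l - m)" and s2: "s\<^sup>2 = l / (l - m)"
      using divide_nonneg_pos[of "- m" "l - m"] divide_nonneg_pos[of l "l - m"] signs gap
      by (simp_all only: c_def s_def real_sqrt_pow2 neg_0_le_iff_le)
    have cs: "c\<^sup>2 + s\<^sup>2 = 1"
      unfolding c2 s2 add_divide_distrib[symmetric] using gap by simp
    have iso: "l * c\<^sup>2 + m * s\<^sup>2 = 0"
      by (simp add: c2 s2 mult.commute)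
    define e1 e2 e3 where "e1 = c *\<^sub>R w - s *\<^sub>R u" and "e2 = cross3 u w" and "e3 = c *\<^sub>R u + s *\<^sub>R w"
    have e2: "norm e2 = 1" "u \<bullet> e2 = 0" "w \<bullet> e2 = 0"
      using norm_cross_dot[of u w] u(1) w(1) uw
      by (simp_all add: e2_def dot_cross_self power2_eq_1_iff)
        (use norm_ge_zero[of "cross3 u w"] in linarith)
    have e2': "e2 \<bullet> u = 0" "e2 \<bullet> w = 0"
      using e2(2,3) by (simp_all add: inner_commute)
    have uu: "u \<bullet> u = 1" "w \<bullet> w = 1"
      using u(1) w(1) by (simp_all add: norm_eq_1)
    have norms: "norm e1 = 1" "norm e3 = 1"
      using cs by (simp_all add: norm_eq_1 e1_def e3_def inner_simps uw uu inner_commute[of w u]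
          power2_eq_square algebra_simps)
    have orth: "orthogonal e1 e2" "orthogonal e1 e3" "orthogonal e2 e3"
      by (simp_all add: orthogonal_def e1_def e3_def inner_simps uw uu e2 e2' inner_commute[of w u])
    note ortho = norms(1) e2(1) norms(2) orth
    have Se1: "S *v e1 = (c * m) *\<^sub>R w - (s * l) *\<^sub>R u"
      by (simp add: e1_def matrix_vector_mult_diff_distrib matrix_vector_mult_scaleR u w)
    have Se3: "S *v e3 = (c * l) *\<^sub>R u + (s * m) *\<^sub>R w"
      by (simp add: e3_def matrix_vector_right_distrib matrix_vector_mult_scaleR u w)
    define A B where "A = l + m" and "B = 2 * (e1 \<bullet> (S *v e3))"
    have "e3 \<bullet> (S *v e3) = l * c\<^sup>2 + m * s\<^sup>2"
      by (simp add: Se3) (simp add: e3_def inner_simps uw uu inner_commute[of w u] power2_eq_square)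
    then have 33: "e3 \<bullet> (S *v e3) = 0"
      using iso by simp
    (* The trace of q on the plane of u and w is l + m, and e3 contributes nothing to it. *)
    have "e1 \<bullet> (S *v e1) = (l + m) * (c\<^sup>2 + s\<^sup>2) - (l * c\<^sup>2 + m * s\<^sup>2)"
      by (simp add: Se1) (simp add: e1_def inner_simps uw uu inner_commute[of w u]
          power2_eq_square algebra_simps)
    then have 11: "e1 \<bullet> (S *v e1) = A"
      using iso cs by (simp add: A_def)
    have 22: "e2 \<bullet> (S *v e2) = - A"
      using trace_eq_sum_orthonormal3[OF ortho, of S] tr 11 33 by simp
    (* S maps the plane of u and w, which is orthogonal to e2, to itself. *)
    have 21: "e2 \<bullet> (S *v e1) = 0" and 23: "e2 \<bullet> (S *v e3) = 0"
      by (simp_all add: Se1 Se3 inner_simps e2')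
    have "q (x *\<^sub>R e1 + y *\<^sub>R e2 + z *\<^sub>R e3) = A * (x\<^sup>2 - y\<^sup>2) + B * x * z" for x y z
      using symmetric_matrix_inner_commute[OF sym, of e1 e2]
        symmetric_matrix_inner_commute[OF sym, of e3 e2]
        symmetric_matrix_inner_commute[OF sym, of e3 e1]
      by (simp add: q matrix_vector_right_distrib matrix_vector_mult_scaleR inner_simps
          11 22 33 21 23 B_def power2_eq_square algebra_simps)
    moreover have "orthonormal_basis3 e1 e2 e3"
      using ortho by (rule orthonormal_basis3I)
    ultimately show ?thesis
      by blast
  qed
qed

end
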